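(* Let $n\ge 1$, let $A\in\mathbb{R}^{n\times n}$ be a fixed matrix, let $B=(A+A^{\mathrm T})/2$, and let $\rho(B)$ be the spectral radius of $B$. For a fixed $x\in S^{n-1}$, the function $F:SO(n)\to\mathbb{R}$ defined by $F(M)=(Mx)^{\mathrm T}A(Mx)$ is Lipschitz with Lipschitz constant $2\rho(B)$, where $SO(n)$ is equipped with the Hilbert–Schmidt metric; that is, $|F(P)-F(Q)|\le 2\rho(B)\,\|P-Q\|_{HS}$ for all $P,Q\in SO(n)$. Consequently, if $M$ is a Haar-distributed random element of $SO(n)$, then for every $t>0$, $$\mathbb{P}\left(F(M)\ge \mathbb{E}F(M)+t\right)\le \exp\left\{-\frac{(n-2)t^2}{64\,\rho(B)^2}\right\}.$$
   Context: $S^{n-1}$ is the Euclidean unit sphere in $\mathbb{R}^n$. $SO(n)$ is the special orthogonal group, with normalized Haar (probability) measure. The Hilbert–Schmidt metric is $\|P-Q\|_{HS}=\sqrt{\operatorname{tr}((P-Q)^{\mathrm T}(P-Q))}$. *)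

theory Defs
  imports "HOL-Probability.Probability"
begin

definition SO :: "(real^'n^'n) set" where
  "SO = {M. rotation_matrix M}"

definition hs_dist :: "real^'n^'n \<Rightarrow> real^'n^'n \<Rightarrow> real" where
  "hs_dist P Q = sqrt (trace (transpose (P - Q) ** (P - Q)))"

definition symmetric_part :: "real^'n^'n \<Rightarrow> real^'n^'n" where
  "symmetric_part A = (1/2) *\<^sub>R (A + transpose A)"

text \<open>The eigenvalues of a real matrix are taken over the complex numbers.\<close>

definition eigenvalues :: "real^'n^'n \<Rightarrow> complex set" where
  "eigenvalues B = {z. \<exists>v :: complex^'n. v \<noteq> 0 \<and> map_matrix complex_of_real B *v v = z *s v}"

definition spectral_radius :: "real^'n^'n \<Rightarrow> real" where
  "spectral_radius B = (SUP z\<in>eigenvalues B. cmod z)"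

definition quad_at :: "real^'n^'n \<Rightarrow> real^'n \<Rightarrow> real^'n^'n \<Rightarrow> real" where
  "quad_at A x M = (M *v x) \<bullet> (A *v (M *v x))"

abbreviation borel_SO :: "(real^'n^'n) measure" where
  "borel_SO \<equiv> restrict_space borel SO"

text \<open>Normalized Haar measure on the compact group \<^const>\<open>SO\<close>, by its defining property: it is
  the (unique) left-invariant Borel probability measure, where left translation of a Borel set
  \<open>E\<close> by a group element \<open>P\<close> is the image of \<open>E\<close> under \<open>M \<mapsto> P ** M\<close>.\<close>

definition normalized_haar_SO :: "(real^'n^'n) measure \<Rightarrow> bool" where
  "normalized_haar_SO \<mu> \<longleftrightarrow>
     prob_space \<mu> \<and> sets \<mu> = sets borel_SO \<and>
     (\<forall>P\<in>SO. \<forall>E\<in>sets \<mu>. emeasure \<mu> ((\<lambda>M. P ** M) ` E) = emeasure \<mu> E)"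

definition haar_distributed_SO :: "'b measure \<Rightarrow> ('b \<Rightarrow> real^'n^'n) \<Rightarrow> bool" where
  "haar_distributed_SO S M \<longleftrightarrow>
     prob_space S \<and> M \<in> measurable S borel_SO \<and> normalized_haar_SO (distr S borel_SO M)"

end

theory Submission
  imports Defs
begin

text \<open>For the Lipschitz bound, put \<open>y = P x\<close> and \<open>z = Q x\<close>; then \<open>F P - F Q = (y - z) \<bullet> B (y + z)\<close> and
  the spectral theorem gives \<open>\<parallel>B v\<parallel> \<le> \<rho> \<parallel>v\<parallel>\<close>. The tail bound is proved without isoperimetry or
  logarithmic Sobolev inequalities: \<open>M x\<close> is uniform on the sphere, hence distributed like \<open>z / \<parallel>z\<parallel>\<close> for
  a Gaussian vector \<open>z\<close>, and the mean of \<open>F\<close> is \<open>m = tr B / n\<close>. With \<open>\<lambda>\<^sub>i\<close> the eigenvalues of \<open>B\<close>, the event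
  \<open>F M \<ge> m + t\<close> is the homogeneous condition \<open>z \<bullet> B z - (m + t) \<parallel>z\<parallel>\<^sup>2 \<ge> 0\<close>, whose Gaussian
  probability is at most \<open>\<Prod>i. (1 - 2 s (\<lambda>\<^sub>i - m - t)) powr (-1/2)\<close> by Markov's
  inequality applied to the exponential. With \<open>s = t / (20 \<rho>\<^sup>2)\<close> and \<open>t \<le> 2 \<rho>\<close> this is at most \<open>exp (- n t\<^sup>2 / (40 \<rho>\<^sup>2))\<close>; for \<open>t > 2 \<rho>\<close> the event is
  null, and for \<open>n \<le> 2\<close> the claimed bound is at least \<open>1\<close>.\<close>

section \<open>Diagonalization of symmetric matrices\<close>

text \<open>A maximizer of the Rayleigh form \<open>x \<bullet> f x\<close> on the compact unit
  sphere of \<open>S\<close> is an eigenvector: its residual \<open>f v - l v\<close> is orthogonal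
  to \<open>v\<close>, and moving in that direction would otherwise increase the form to first
  order.\<close>

lemma symmetric_eigenvector_exists:
  fixes f :: "'a::euclidean_space \<Rightarrow> 'a"
  assumes lin: "linear f" and sym: "\<And>x y. f x \<bullet> y = x \<bullet> f y"
    and S: "subspace S" "f ` S \<subseteq> S" and nz: "S \<noteq> {0}"
  obtains v l where "v \<in> S" "norm v = 1" "f v = l *\<^sub>R v"
proof -
  interpret f: linear f by fact
  obtain w where w: "w \<in> S" "w \<noteq> 0" using nz subspace_0[OF S(1)] by blast
  have "compact (S \<inter> sphere 0 1)"
    by (simp add: closed_Int_compact closed_subspace S)
  moreover have "w /\<^sub>R norm w \<in> S \<inter> sphere 0 1"
    using w S by (simp add: subspace_scale)
  moreover have "continuous_on (S \<inter> sphere 0 1) (\<lambda>x. x \<bullet> f x)"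
    by (intro continuous_intros linear_continuous_on linear_conv_bounded_linear[THEN iffD1] lin)
  ultimately obtain v where v: "v \<in> S \<inter> sphere 0 1"
    and max: "\<And>x. x \<in> S \<inter> sphere 0 1 \<Longrightarrow> x \<bullet> f x \<le> v \<bullet> f v"
    using continuous_attains_sup[of "S \<inter> sphere 0 1" "\<lambda>x. x \<bullet> f x"] by blast
  define l where "l = v \<bullet> f v"
  have le: "x \<bullet> f x \<le> l * (x \<bullet> x)" if "x \<in> S" for x
  proof (cases "x = 0")
    case False
    have "(x /\<^sub>R norm x) \<bullet> f (x /\<^sub>R norm x) \<le> l"
      unfolding l_def using False that S by (intro max) (simp add: subspace_scale)
    with False show ?thesis
      by (simp add: f.scale field_simps dot_square_norm power2_eq_square)
  qed (simp add: f.zero)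
  define u where "u = f v - l *\<^sub>R v"
  have u: "u \<in> S" unfolding u_def using v S by (auto intro!: subspace_diff subspace_scale)
  have vv: "v \<bullet> v = 1" using v by (simp add: dot_square_norm)
  have uv: "u \<bullet> v = 0" unfolding u_def inner_diff_left using vv by (simp add: l_def inner_commute)
  \<comment> \<open>The maximality inequality is tested at \<open>v + e *\<^sub>R u\<close>. The
    terms of order zero cancel because \<open>v\<close> is a unit vector orthogonal to
    \<open>u\<close>, and one factor \<open>e\<close> is divided out.\<close>
  have *: "2 * (u \<bullet> f v) \<le> e * (l * (u \<bullet> u) - u \<bullet> f u)" if "e > 0" for e
  proof -
    have "v + e *\<^sub>R u \<in> S" using v u S by (auto intro!: subspace_add subspace_scale)
    from le[OF this] have "e * (2 * (u \<bullet> f v)) \<le> e * (e * (l * (u \<bullet> u) - u \<bullet> f u))"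
      using vv uv sym[of v u]
      by (simp add: f.add f.scale algebra_simps inner_commute flip: l_def)
    with that show ?thesis by simp
  qed
  have "u \<bullet> f v \<le> 0"
  proof (rule ccontr)
    assume "\<not> u \<bullet> f v \<le> 0"
    \<comment> \<open>The step size \<open>c / (\<bar>d\<bar> + 1)\<close> keeps the second-order
      term at most \<open>c\<close>, which contradicts the lower bound \<open>2 * c\<close>.\<close>
    define c d where "c = u \<bullet> f v" and "d = l * (u \<bullet> u) - u \<bullet> f u"
    have "c > 0" using \<open>\<not> u \<bullet> f v \<le> 0\<close> c_def by simp
    have "2 * c \<le> (c / (\<bar>d\<bar> + 1)) * d" using *[of "c / (\<bar>d\<bar> + 1)"] \<open>c > 0\<close> by (simp add: c_def d_def)
    also have "\<dots> = c * (d / (\<bar>d\<bar> + 1))" by simp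
    also have "\<dots> \<le> c * 1" using \<open>c > 0\<close> by (intro mult_left_mono) (auto simp: field_simps)
    finally show False using \<open>c > 0\<close> by simp
  qed
  moreover have "u \<bullet> u = u \<bullet> f v"
    using uv inner_diff_right[of u "f v" "l *\<^sub>R v"] by (simp flip: u_def)
  ultimately have "u = 0" by (metis inner_ge_zero inner_eq_zero_iff antisym)
  then show thesis using that[of v l] v by (simp add: u_def)
qed

text \<open>Induction on the dimension: a unit eigenvector \<open>v\<close> is split off, and by
  symmetry of \<open>f\<close> the orthogonal complement of \<open>v\<close> in \<open>S\<close> is
  again invariant.\<close>

lemma symmetric_orthonormal_eigenbasis_subspace:
  fixes f :: "'a::euclidean_space \<Rightarrow> 'a"
  assumes lin: "linear f" and sym: "\<And>x y. f x \<bullet> y = x \<bullet> f y"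
    and "subspace S" "f ` S \<subseteq> S"
  shows "\<exists>B \<subseteq> S. pairwise orthogonal B \<and> (\<forall>b\<in>B. norm b = 1 \<and> (\<exists>l. f b = l *\<^sub>R b)) \<and> span B = S"
  using assms(3,4)
proof (induction "dim S" arbitrary: S rule: less_induct)
  case less
  show ?case
  proof (cases "S = {0}")
    case True
    then show ?thesis by (intro exI[of _ "{}"]) auto
  next
    case False
    then obtain v l where v: "v \<in> S" "norm v = 1" "f v = l *\<^sub>R v"
      using symmetric_eigenvector_exists[OF lin sym less.prems] by blast
    define T where "T = S \<inter> {y. v \<bullet> y = 0}"
    have T: "subspace T" unfolding T_def by (intro subspace_inter less.prems subspace_hyperplane)
    have fT: "f ` T \<subseteq> T" using less.prems(2) v sym[of v, symmetric] by (auto simp: T_def)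
    have "v \<notin> T" using v by (auto simp: T_def)
    then have "dim T < dim S"
      using v(1) less.prems(1) T by (intro dim_psubset) (simp only: span_eq_iff[THEN iffD2], unfold T_def, blast)
    from less.hyps[OF this T fT] obtain B where B: "B \<subseteq> T" "pairwise orthogonal B"
      "\<forall>b\<in>B. norm b = 1 \<and> (\<exists>l. f b = l *\<^sub>R b)" "span B = T" by blast
    have "S \<subseteq> span (insert v B)"
    proof
      fix x assume "x \<in> S"
      have "x - (v \<bullet> x) *\<^sub>R v \<in> T"
        using \<open>x \<in> S\<close> v less.prems(1)
        by (auto simp: T_def inner_diff_right dot_square_norm intro!: subspace_diff subspace_scale)
      then show "x \<in> span (insert v B)" using B(4) span_breakdown_eq by blast
    qed
    moreover have "span (insert v B) \<subseteq> S"
      using v B(1) less.prems(1) by (intro span_minimal) (auto simp: T_def)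
    moreover have "pairwise orthogonal (insert v B)"
      using B(1,2) by (auto simp: pairwise_insert T_def orthogonal_def inner_commute)
    ultimately show ?thesis using v B(1,3) by (intro exI[of _ "insert v B"]) (auto simp: T_def)
  qed
qed

lemma orthogonal_matrix_mult_transpose:
  fixes U :: "real^'n^'n"
  assumes "orthogonal_matrix U"
  shows "U *v (transpose U *v x) = x"
  using assms by (auto simp add: orthogonal_matrix_def matrix_vector_mul_assoc simp del: transpose_matrix_vector)

definition diagonal_matrix :: "('n \<Rightarrow> real) \<Rightarrow> real^'n^'n" where
  "diagonal_matrix l = (\<chi> i j. if i = j then l i else 0)"

lemma diagonal_matrix_vector_mult: "diagonal_matrix l *v x = (\<chi> i. l i * x $ i)"
  by (simp add: diagonal_matrix_def matrix_vector_mult_def vec_eq_iff if_distrib[of "\<lambda>c. c * _"] cong: if_cong)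

lemma trace_diagonal_matrix: "trace (diagonal_matrix l) = (\<Sum>i\<in>UNIV. l i)"
  by (simp add: trace_def diagonal_matrix_def)

text \<open>An orthonormal eigenbasis has as many elements as the index type, so a bijection turns
  it into the columns of \<open>U\<close>. The eigenvector equations are kept beside the
  factorization because they tie each \<open>l i\<close> to the spectral radius.\<close>

lemma symmetric_matrix_diagonalization:
  fixes B :: "real^'n^'n"
  assumes "transpose B = B"
  obtains U l where "orthogonal_matrix U" "\<And>i. B *v column i U = l i *\<^sub>R column i U"
    "B = U ** diagonal_matrix l ** transpose U"
proof -
  have "(B *v x) \<bullet> y = x \<bullet> (B *v y)" for x y
    using dot_lmul_matrix[of x B y] assms transpose_matrix_vector[of B x] by metis
  then obtain E where E: "pairwise orthogonal E" "\<forall>b\<in>E. norm b = 1 \<and> (\<exists>l. B *v b = l *\<^sub>R b)" "span E = UNIV"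
    using symmetric_orthonormal_eigenbasis_subspace[OF matrix_vector_mul_linear[of B], of UNIV] subspace_UNIV by blast
  have "0 \<notin> E" using E(2) by force
  then have "independent E"
    by (intro pairwise_orthogonal_independent E(1))
  then have "card E = CARD('n)" "finite E"
    using dim_eq_card[of E UNIV] E(3) independent_imp_finite by auto
  then obtain g where g: "bij_betw g (UNIV::'n set) E"
    by (metis finite_class.finite_UNIV finite_same_card_bij)
  define U where "U = (\<chi> i j. g j $ i)"
  have col: "column i U = g i" for i by (simp add: U_def column_def)
  have U: "orthogonal_matrix U"
    unfolding orthogonal_matrix_orthonormal_columns col
  proof (intro conjI allI impI)
    show "norm (g i) = 1" for i using E(2) g bij_betwE by blast
    show "orthogonal (g i) (g j)" if "i \<noteq> j" for i j
      using E(1) g that by (auto simp: bij_betw_def inj_on_def pairwise_def)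
  qed
  have "\<forall>i. \<exists>l. B *v g i = l *\<^sub>R g i" using E(2) g by (auto simp: bij_betw_def)
  then obtain l where l: "\<And>i. B *v g i = l i *\<^sub>R g i" by metis
  have "B ** U = U ** diagonal_matrix l"
  proof -
    have "(B ** U) $ a $ b = (U ** diagonal_matrix l) $ a $ b" for a b
    proof -
      have "(B ** U) $ a $ b = (B *v g b) $ a"
        by (simp add: matrix_matrix_mult_def matrix_vector_mult_def U_def)
      also have "\<dots> = l b * g b $ a" by (simp add: l)
      also have "\<dots> = (U ** diagonal_matrix l) $ a $ b"
        by (simp add: matrix_matrix_mult_def U_def diagonal_matrix_def if_distrib cong: if_cong)
      finally show ?thesis .
    qed
    then show ?thesis by (simp add: vec_eq_iff)
  qed
  then have "B ** U ** transpose U = U ** diagonal_matrix l ** transpose U"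
    by (rule arg_cong)
  moreover have "B ** U ** transpose U = B"
    using U by (metis matrix_mul_assoc matrix_mul_rid orthogonal_matrix_def)
  ultimately have "B = U ** diagonal_matrix l ** transpose U" by simp
  then show thesis using that[OF U, of l] l unfolding col by blast
qed

section \<open>Spectral radius and the Lipschitz bound\<close>

text \<open>The eigenvalue equation is read in a coordinate where \<open>v\<close> has maximal
  modulus. The crude bound serves to show that the supremum defining \<open>spectral_radius\<close>
  is over a bounded set.\<close>

lemma eigenvalue_norm_le:
  assumes "z \<in> eigenvalues B"
  shows "cmod z \<le> (\<Sum>i\<in>UNIV. \<Sum>j\<in>UNIV. \<bar>B $ i $ j\<bar>)"
proof -
  obtain v where v: "v \<noteq> 0" "map_matrix complex_of_real B *v v = z *s v"
    using assms by (auto simp: eigenvalues_def)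
  define m where "m = Max (range (\<lambda>i. cmod (v $ i)))"
  have le: "cmod (v $ j) \<le> m" for j unfolding m_def by (intro Max_ge) auto
  have "m \<in> range (\<lambda>i. cmod (v $ i))" unfolding m_def by (intro Max_in) auto
  then obtain i where i: "m = cmod (v $ i)" by blast
  obtain k where "v $ k \<noteq> 0" using v(1) by (auto simp: vec_eq_iff)
  then have "m > 0" using le[of k] by (metis less_le_trans zero_less_norm_iff)
  have "(\<Sum>j\<in>UNIV. complex_of_real (B $ i $ j) * v $ j) = z * v $ i"
    using arg_cong[OF v(2), of "\<lambda>w. w $ i"] by (simp add: matrix_vector_mult_def)
  then have "cmod z * m = cmod (\<Sum>j\<in>UNIV. complex_of_real (B $ i $ j) * v $ j)"
    by (simp add: i norm_mult)
  also have "\<dots> \<le> (\<Sum>j\<in>UNIV. \<bar>B $ i $ j\<bar> * m)"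
    by (intro sum_norm_le) (simp add: norm_mult le mult_left_mono)
  also have "\<dots> = (\<Sum>j\<in>UNIV. \<bar>B $ i $ j\<bar>) * m" by (simp add: sum_distrib_right)
  finally have "cmod z \<le> (\<Sum>j\<in>UNIV. \<bar>B $ i $ j\<bar>)" using \<open>m > 0\<close> by simp
  also have "\<dots> \<le> (\<Sum>i\<in>UNIV. \<Sum>j\<in>UNIV. \<bar>B $ i $ j\<bar>)"
    by (rule member_le_sum) (auto intro: sum_nonneg)
  finally show ?thesis .
qed

lemma real_eigenvalue_le_spectral_radius:
  fixes B :: "real^'n^'n"
  assumes "v \<noteq> 0" "B *v v = l *\<^sub>R v"
  shows "\<bar>l\<bar> \<le> spectral_radius B"
proof -
  define w where "w = (\<chi> i. complex_of_real (v $ i))"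
  have "w \<noteq> 0" using assms(1) by (auto simp: w_def vec_eq_iff)
  moreover have "map_matrix complex_of_real B *v w = complex_of_real l *s w"
  proof -
    have "(\<Sum>j\<in>UNIV. B $ i $ j * v $ j) = l * v $ i" for i
      using arg_cong[OF assms(2), of "\<lambda>w. w $ i"] by (simp add: matrix_vector_mult_def)
    from arg_cong[OF this, of complex_of_real] show ?thesis
      by (simp add: w_def vec_eq_iff matrix_vector_mult_def)
  qed
  ultimately have "complex_of_real l \<in> eigenvalues B"
    unfolding eigenvalues_def by blast
  moreover have "bdd_above (cmod ` eigenvalues B)"
    using eigenvalue_norm_le by (auto intro!: bdd_aboveI)
  ultimately have "cmod (complex_of_real l) \<le> spectral_radius B"
    unfolding spectral_radius_def by (intro cSUP_upper)
  then show ?thesis by simp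
qed

lemma orthogonal_matrix_norm:
  fixes U :: "real^'n^'n"
  assumes "orthogonal_matrix U"
  shows "norm (U *v x) = norm x"
  using assms orthogonal_transformation_matrix[of "(*v) U"]
  by (simp add: orthogonal_transformation)

lemma norm_vec_square:
  fixes x :: "real^'n"
  shows "(norm x)\<^sup>2 = (\<Sum>i\<in>UNIV. (x $ i)\<^sup>2)"
  unfolding power2_norm_eq_inner inner_vec_def by (simp add: power2_eq_square)

text \<open>A fixed spectral decomposition of \<open>B\<close>; the coordinates of \<open>x\<close>
  in the eigenbasis are those of \<open>transpose U *v x\<close>.\<close>

locale diagonalized =
  fixes B U :: "real^'n^'n" and l :: "'n \<Rightarrow> real"
  assumes U: "orthogonal_matrix U"
    and eigen: "B *v column i U = l i *\<^sub>R column i U"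
    and B_eq: "B = U ** diagonal_matrix l ** transpose U"
begin

lemma eigenvalue_le: "\<bar>l i\<bar> \<le> spectral_radius B"
proof -
  have "norm (column i U) = 1" using U orthogonal_matrix_orthonormal_columns by blast
  then have "column i U \<noteq> 0" by force
  then show ?thesis using eigen by (rule real_eigenvalue_le_spectral_radius)
qed

lemma spectral_radius_nonneg: "0 \<le> spectral_radius B"
  using eigenvalue_le[of undefined] by linarith

lemma mult_eq: "B *v x = U *v (\<chi> i. l i * (transpose U *v x) $ i)"
  by (simp add: B_eq matrix_vector_mul_assoc[symmetric] diagonal_matrix_vector_mult del: transpose_matrix_vector)

lemma norm_transpose [simp]: "norm (transpose U *v x) = norm x"
  using U by (simp add: orthogonal_matrix_norm del: transpose_matrix_vector)

lemma quadratic_form_eq: "x \<bullet> (B *v x) = (\<Sum>i\<in>UNIV. l i * ((transpose U *v x) $ i)\<^sup>2)"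
proof -
  have "x \<bullet> (B *v x) = (transpose U *v x) \<bullet> (\<chi> i. l i * (transpose U *v x) $ i)"
    by (simp add: mult_eq dot_lmul_matrix)
  then show ?thesis by (simp add: inner_vec_def power2_eq_square algebra_simps)
qed

lemma norm_square_eq: "(norm x)\<^sup>2 = (\<Sum>i\<in>UNIV. ((transpose U *v x) $ i)\<^sup>2)"
proof -
  have "(norm x)\<^sup>2 = (norm (transpose U *v x))\<^sup>2" by (simp only: norm_transpose)
  also have "\<dots> = (\<Sum>i\<in>UNIV. ((transpose U *v x) $ i)\<^sup>2)"
    by (rule norm_vec_square)
  finally show ?thesis .
qed

text \<open>In eigenbasis coordinates \<open>B\<close> multiplies each entry by some
  \<open>l i\<close>, and both changes of coordinates preserve the norm.\<close>

lemma norm_mult_le: "norm (B *v x) \<le> spectral_radius B * norm x"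
proof (rule power2_le_imp_le)
  have "(norm (B *v x))\<^sup>2 = (norm (\<chi> i. l i * (transpose U *v x) $ i))\<^sup>2"
    by (simp only: mult_eq orthogonal_matrix_norm[OF U])
  also have "\<dots> = (\<Sum>i\<in>UNIV. (l i)\<^sup>2 * ((transpose U *v x) $ i)\<^sup>2)"
    unfolding norm_vec_square by (simp add: power_mult_distrib)
  also have "\<dots> \<le> (\<Sum>i\<in>UNIV. (spectral_radius B)\<^sup>2 * ((transpose U *v x) $ i)\<^sup>2)"
    using eigenvalue_le spectral_radius_nonneg
    by (intro sum_mono mult_right_mono) (auto simp: abs_le_square_iff[symmetric])
  also have "\<dots> = (spectral_radius B * norm x)\<^sup>2"
    by (simp only: power_mult_distrib norm_square_eq[of x] sum_distrib_left)
  finally show "(norm (B *v x))\<^sup>2 \<le> (spectral_radius B * norm x)\<^sup>2" .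
qed (simp add: spectral_radius_nonneg)

lemma trace_eq: "trace B = (\<Sum>i\<in>UNIV. l i)"
proof -
  have "trace B = trace (transpose U ** (U ** diagonal_matrix l))"
    unfolding B_eq by (rule trace_mul_sym)
  also have "\<dots> = trace (diagonal_matrix l)"
    using U by (simp add: matrix_mul_assoc orthogonal_matrix_def)
  finally show ?thesis by (simp add: trace_diagonal_matrix)
qed

end

section \<open>Symmetric parts, the Hilbert-Schmidt norm and the Lipschitz estimate\<close>

lemma transpose_symmetric_part: "transpose (symmetric_part A) = symmetric_part A"
  by (simp add: symmetric_part_def transpose_def vec_eq_iff algebra_simps)

lemma symmetric_part_diagonalized:
  obtains U l where "diagonalized (symmetric_part A) U l"
  using symmetric_matrix_diagonalization[OF transpose_symmetric_part[of A]]
  by (metis diagonalized.intro)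

text \<open>A matrix and its transpose have the same quadratic form, hence so does their
  average.\<close>

lemma quadratic_form_symmetric_part: "y \<bullet> (A *v y) = y \<bullet> (symmetric_part A *v y)"
proof -
  have "y \<bullet> (transpose A *v y) = y \<bullet> (A *v y)"
    by (simp add: dot_lmul_matrix inner_commute[of y])
  then show ?thesis
    by (simp add: symmetric_part_def matrix_vector_mult_add_rdistrib scaleR_matrix_vector_assoc[symmetric]
        inner_add_right del: transpose_matrix_vector)
qed

lemma quad_at_symmetric_part: "quad_at A x M = (M *v x) \<bullet> (symmetric_part A *v (M *v x))"
  unfolding quad_at_def by (rule quadratic_form_symmetric_part)

text \<open>The Euclidean norm of a matrix viewed as a vector of rows is its Hilbert-Schmidt
  norm.\<close>

lemma hs_dist_eq_norm: "hs_dist P Q = norm (P - Q)"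
proof -
  have "trace (transpose M ** M) = M \<bullet> M" for M :: "real^'n^'n"
    unfolding trace_def matrix_matrix_mult_def inner_vec_def transpose_def
    by (simp, rule sum.swap)
  then show ?thesis by (simp add: hs_dist_def norm_eq_sqrt_inner)
qed

text \<open>Cauchy-Schwarz applied to each row.\<close>

lemma norm_matrix_vector_mult_le:
  fixes M :: "real^'n^'m"
  shows "norm (M *v x) \<le> norm M * norm x"
proof (rule power2_le_imp_le)
  have "(norm (M *v x))\<^sup>2 = (\<Sum>i\<in>UNIV. (M $ i \<bullet> x)\<^sup>2)"
    unfolding power2_norm_eq_inner inner_vec_def matrix_vector_mul_component
    by (simp add: power2_eq_square inner_vec_def)
  also have "\<dots> \<le> (\<Sum>i\<in>UNIV. (M $ i \<bullet> M $ i) * (x \<bullet> x))"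
    by (intro sum_mono) (simp add: Cauchy_Schwarz_ineq)
  also have "\<dots> = (norm M * norm x)\<^sup>2"
    by (simp add: power_mult_distrib power2_norm_eq_inner inner_vec_def[of M] sum_distrib_right)
  finally show "(norm (M *v x))\<^sup>2 \<le> (norm M * norm x)\<^sup>2" .
qed simp

lemma SO_orthogonal: "P \<in> SO \<Longrightarrow> orthogonal_matrix P"
  by (simp add: SO_def rotation_matrix_def)

lemma quad_at_Lipschitz:
  assumes x: "norm x = 1" and P: "P \<in> SO" and Q: "Q \<in> SO"
  shows "\<bar>quad_at A x P - quad_at A x Q\<bar> \<le> 2 * spectral_radius (symmetric_part A) * hs_dist P Q"
proof -
  obtain U l where "diagonalized (symmetric_part A) U l" by (rule symmetric_part_diagonalized)
  then interpret diagonalized "symmetric_part A" U l .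
  let ?B = "symmetric_part A"
  define y z where "y = P *v x" and "z = Q *v x"
  have "y \<bullet> (?B *v z) = z \<bullet> (?B *v y)"
    by (metis dot_lmul_matrix inner_commute transpose_matrix_vector transpose_symmetric_part)
  then have "y \<bullet> (?B *v y) - z \<bullet> (?B *v z) = (y - z) \<bullet> (?B *v (y + z))"
    by (simp add: matrix_vector_right_distrib inner_diff_left inner_add_right)
  also have "\<bar>\<dots>\<bar> \<le> norm (y - z) * norm (?B *v (y + z))" by (rule Cauchy_Schwarz_ineq2)
  also have "\<dots> \<le> norm (y - z) * (spectral_radius ?B * norm (y + z))"
    by (intro mult_left_mono norm_mult_le) simp
  \<comment> \<open>The Lipschitz factor 2 is the triangle inequality for the unit vectors
    \<open>y\<close> and \<open>z\<close>.\<close>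
  also have "\<dots> \<le> hs_dist P Q * (spectral_radius ?B * 2)"
  proof (intro mult_mono)
    show "norm (y - z) \<le> hs_dist P Q"
      using norm_matrix_vector_mult_le[of "P - Q" x] x
      by (simp add: y_def z_def hs_dist_eq_norm matrix_vector_mult_diff_rdistrib)
    have "norm y = 1" "norm z = 1"
      using x P Q by (simp_all add: y_def z_def orthogonal_matrix_norm SO_orthogonal)
    then show "norm (y + z) \<le> 2" using norm_triangle_ineq[of y z] by simp
  qed (auto simp: spectral_radius_nonneg hs_dist_eq_norm)
  finally show ?thesis by (simp add: quad_at_symmetric_part y_def z_def mult_ac)
qed

section \<open>Haar measure on the rotation group\<close>

lemma continuous_on_matrix_vector_mult [continuous_intros]:
  fixes f :: "'a::topological_space \<Rightarrow> real^'n^'m"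
  assumes "continuous_on S f" "continuous_on S g"
  shows "continuous_on S (\<lambda>x. f x *v g x)"
  unfolding matrix_vector_mult_def
  by (intro continuous_intros continuous_on_vec_lambda assms)

lemma continuous_on_matrix_matrix_mult [continuous_intros]:
  fixes f :: "'a::topological_space \<Rightarrow> real^'n^'m" and g :: "'a \<Rightarrow> real^'k^'n"
  assumes "continuous_on S f" "continuous_on S g"
  shows "continuous_on S (\<lambda>x. f x ** g x)"
  unfolding matrix_matrix_mult_def
  by (intro continuous_intros continuous_on_vec_lambda assms)

lemma continuous_on_transpose [continuous_intros]:
  fixes f :: "'a::topological_space \<Rightarrow> real^'n^'m"
  assumes "continuous_on S f"
  shows "continuous_on S (\<lambda>x. transpose (f x))"
  unfolding transpose_def
  by (intro continuous_intros continuous_on_vec_lambda assms)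

lemma continuous_on_matrix_det [continuous_intros]:
  fixes f :: "'a::topological_space \<Rightarrow> real^'n^'n"
  assumes "continuous_on S f"
  shows "continuous_on S (\<lambda>x. det (f x))"
  unfolding det_def by (intro continuous_intros assms)

lemma closed_SO: "closed (SO :: (real^'n^'n) set)"
proof -
  have eq: "SO = {M :: real^'n^'n. transpose M ** M = mat 1} \<inter> {M. det M = 1}"
    by (auto simp: SO_def rotation_matrix_def orthogonal_matrix)
  show ?thesis
    unfolding eq by (intro closed_Int closed_Collect_eq continuous_intros)
qed

lemma SO_transpose: "P \<in> SO \<Longrightarrow> transpose P \<in> SO"
  by (simp add: SO_def rotation_matrix_def det_transpose)

lemma SO_mult: "P \<in> SO \<Longrightarrow> Q \<in> SO \<Longrightarrow> P ** Q \<in> SO"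
  by (simp add: SO_def rotation_matrix_def orthogonal_matrix_mul det_mul)

text \<open>In dimension 1 the group is trivial and cannot carry \<open>x\<close> to
  \<open>- x\<close>, hence the lower bound on the dimension.\<close>

lemma SO_transitive:
  fixes x z :: "real^'n"
  assumes "2 \<le> CARD('n)" "norm x = norm z"
  obtains P where "P \<in> SO" "P *v x = z"
proof -
  obtain f where "orthogonal_transformation f" "det (matrix f) = 1" "f x = z"
    using rotation_exists[OF assms] .
  then show thesis
    using that[of "matrix f"]
    by (simp add: SO_def rotation_matrix_def orthogonal_transformation_matrix matrix_works
        matrix_vector_mul(2) linear_matrix_vector_mul_eq)
qed

text \<open>The summands are the diagonal entries of \<open>M ** B ** transpose M\<close>, whose
  trace is that of \<open>B\<close> by cyclicity. This makes the mean of the quadratic form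
  computable.\<close>

lemma sum_axis_quadratic_form:
  fixes M B :: "real^'n^'n"
  assumes "orthogonal_matrix M"
  shows "(\<Sum>i\<in>UNIV. (transpose M *v axis i 1) \<bullet> (B *v (transpose M *v axis i 1))) = trace B"
proof -
  have "(transpose M *v axis i 1) \<bullet> (B *v (transpose M *v axis i 1)) = (M ** (B ** transpose M)) $ i $ i" for i
  proof -
    have "(transpose M *v axis i 1) \<bullet> (B *v (transpose M *v axis i 1))
        = axis i 1 \<bullet> ((M ** (B ** transpose M)) *v axis i 1)"
      by (simp add: dot_lmul_matrix flip: matrix_vector_mul_assoc)
    also have "\<dots> = (M ** (B ** transpose M)) $ i $ i"
      by (simp add: inner_axis' matrix_vector_mul_component cart_eq_inner_axis[symmetric])
    finally show ?thesis .
  qed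
  then have "(\<Sum>i\<in>UNIV. (transpose M *v axis i 1) \<bullet> (B *v (transpose M *v axis i 1))) = trace (M ** (B ** transpose M))"
    by (simp add: trace_def)
  also have "\<dots> = trace ((B ** transpose M) ** M)" by (rule trace_mul_sym)
  also have "\<dots> = trace B" using assms by (simp add: orthogonal_matrix_def flip: matrix_mul_assoc)
  finally show ?thesis .
qed

section \<open>Averages over a left-invariant probability measure on rotations\<close>

lemma borel_measurable_quadratic_form [measurable]:
  fixes B :: "real^'n^'n"
  shows "(\<lambda>y. y \<bullet> (B *v y)) \<in> borel_measurable borel"
  by (intro borel_measurable_continuous_onI continuous_intros)

text \<open>Haar measure regarded as a Borel measure on all matrices, concentrated on
  \<open>SO\<close>. Continuous functions of matrices are then measurable directly, and invariance
  is an equality of push-forwards.\<close>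

locale SO_left_invariant = prob_space L for L :: "(real^'n^'n) measure" +
  assumes sets_L [measurable_cong]: "sets L = sets borel"
    and AE_SO: "AE M in L. M \<in> SO"
    and left_invariant: "P \<in> SO \<Longrightarrow> distr L borel ((**) P) = L"
begin

lemma pair_sigma_finite_self: "pair_sigma_finite L L"
  by (intro pair_sigma_finite.intro prob_space_imp_sigma_finite prob_space_axioms)

lemma nn_integral_left_mult:
  assumes [measurable]: "f \<in> borel_measurable borel" and P: "P \<in> SO"
  shows "(\<integral>\<^sup>+M. f (P ** M) \<partial>L) = (\<integral>\<^sup>+M. f M \<partial>L)"
proof -
  have [measurable]: "(**) P \<in> borel_measurable borel"
    by (intro borel_measurable_continuous_onI continuous_intros)
  have "(\<integral>\<^sup>+M. f M \<partial>L) = (\<integral>\<^sup>+M. f M \<partial>distr L borel ((**) P))" using left_invariant[OF P] by simp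
  also have "\<dots> = (\<integral>\<^sup>+M. f (P ** M) \<partial>L)" by (intro nn_integral_distr) measurable
  finally show ?thesis ..
qed

lemma borel_measurable_vector_mult [measurable]: "(\<lambda>M. M *v x) \<in> borel_measurable L"
  using sets_L by (subst measurable_cong_sets[OF sets_L refl])
    (intro borel_measurable_continuous_onI continuous_intros)

lemma borel_measurable_transpose_vector_mult [measurable]: "(\<lambda>M. transpose M *v x) \<in> borel_measurable L"
  using sets_L by (subst measurable_cong_sets[OF sets_L refl])
    (intro borel_measurable_continuous_onI continuous_intros)

text \<open>Integrate \<open>\<phi> (N\<^sup>T M x)\<close> over \<open>M\<close> and \<open>N\<close>: left invariance in \<open>M\<close> removes \<open>N\<close>, and left
  invariance in \<open>N\<close> removes \<open>M\<close>.\<close>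

lemma nn_integral_transpose:
  fixes \<phi> :: "real^'n \<Rightarrow> ennreal"
  assumes [measurable]: "\<phi> \<in> borel_measurable borel"
  shows "(\<integral>\<^sup>+M. \<phi> (M *v x) \<partial>L) = (\<integral>\<^sup>+M. \<phi> (transpose M *v x) \<partial>L)"
proof -
  interpret pair_sigma_finite L L by (rule pair_sigma_finite_self)
  have [measurable]: "(\<lambda>M. \<phi> (M *v x)) \<in> borel_measurable borel" 
    by (intro measurable_compose[OF _ assms] borel_measurable_continuous_onI continuous_intros)
  have [measurable]: "(\<lambda>M. \<phi> (transpose M *v x)) \<in> borel_measurable borel"
    by (intro measurable_compose[OF _ assms] borel_measurable_continuous_onI continuous_intros)
  have sets_pair: "sets (L \<Otimes>\<^sub>M L) = sets borel"
    unfolding borel_prod[symmetric] by (intro sets_pair_measure_cong sets_L)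
  have "(\<lambda>p. \<phi> (transpose (fst p) *v (snd p *v x))) \<in> borel_measurable borel"
    by (intro measurable_compose[OF _ assms] borel_measurable_continuous_onI continuous_intros)
  then have joint [measurable]: "(\<lambda>(N, M). \<phi> (transpose N *v (M *v x))) \<in> borel_measurable (L \<Otimes>\<^sub>M L)"
    by (subst measurable_cong_sets[OF sets_pair refl]) (simp add: split_beta')
  have "(\<integral>\<^sup>+M. \<phi> (M *v x) \<partial>L) = (\<integral>\<^sup>+N. (\<integral>\<^sup>+M. \<phi> (M *v x) \<partial>L) \<partial>L)"
    by (simp add: emeasure_space_1)
  also have "\<dots> = (\<integral>\<^sup>+N. (\<integral>\<^sup>+M. \<phi> (transpose N *v (M *v x)) \<partial>L) \<partial>L)"
  proof (rule nn_integral_cong_AE, use AE_SO in eventually_elim)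
    case (elim N)
    from nn_integral_left_mult[OF _ SO_transpose[OF this], of "\<lambda>M. \<phi> (M *v x)"]
    show ?case by (simp add: matrix_vector_mul_assoc)
  qed
  also have "\<dots> = (\<integral>\<^sup>+M. (\<integral>\<^sup>+N. \<phi> (transpose N *v (M *v x)) \<partial>L) \<partial>L)"
    by (rule Fubini'[symmetric]) (rule joint)
  also have "\<dots> = (\<integral>\<^sup>+M. (\<integral>\<^sup>+N. \<phi> (transpose N *v x) \<partial>L) \<partial>L)"
  proof (rule nn_integral_cong_AE, use AE_SO in eventually_elim)
    case (elim M)
    from nn_integral_left_mult[OF _ SO_transpose[OF this], of "\<lambda>M. \<phi> (transpose M *v x)"]
    show ?case by (simp add: matrix_vector_mul_assoc matrix_transpose_mul del: transpose_matrix_vector)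
  qed
  also have "\<dots> = (\<integral>\<^sup>+M. \<phi> (transpose M *v x) \<partial>L)"
    by (simp add: emeasure_space_1)
  finally show ?thesis .
qed

text \<open>After passing to the transpose, left multiplication of \<open>M\<close> by
  \<open>transpose P\<close> replaces \<open>x\<close> by \<open>P *v x\<close>. So left invariance
  alone moves the starting vector around its sphere.\<close>

lemma nn_integral_transpose_sphere:
  fixes \<phi> :: "real^'n \<Rightarrow> ennreal"
  assumes [measurable]: "\<phi> \<in> borel_measurable borel"
    and card: "2 \<le> CARD('n)" and xz: "norm x = norm z"
  shows "(\<integral>\<^sup>+M. \<phi> (M *v x) \<partial>L) = (\<integral>\<^sup>+M. \<phi> (transpose M *v z) \<partial>L)"
proof -
  obtain P where P: "P \<in> SO" "P *v x = z" using SO_transitive[OF card xz] .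
  have [measurable]: "(\<lambda>M. \<phi> (transpose M *v x)) \<in> borel_measurable borel"
    by (intro measurable_compose[OF _ assms(1)] borel_measurable_continuous_onI continuous_intros)
  from nn_integral_left_mult[OF this SO_transpose[OF P(1)]]
  have "(\<integral>\<^sup>+M. \<phi> (transpose M *v z) \<partial>L) = (\<integral>\<^sup>+M. \<phi> (transpose M *v x) \<partial>L)"
    by (simp add: matrix_transpose_mul matrix_vector_mul_assoc[symmetric] P(2) del: transpose_matrix_vector)
  then show ?thesis by (simp add: nn_integral_transpose)
qed

text \<open>Indicator functions upgrade the equality of nonnegative integrals to an equality of
  laws, so that real integrals can be compared without integrability assumptions.\<close>

lemma distr_transpose_sphere:
  assumes "2 \<le> CARD('n)" "norm x = norm z"
  shows "distr L borel (\<lambda>M. M *v x) = distr L borel (\<lambda>M. transpose M *v z)"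
proof (rule measure_eqI)
  fix E :: "(real^'n) set" assume "E \<in> sets (distr L borel (\<lambda>M. M *v x))"
  then have [measurable]: "E \<in> sets borel" by simp
  have "emeasure (distr L borel f) E = (\<integral>\<^sup>+M. indicator E (f M) \<partial>L)"
    if [measurable]: "f \<in> borel_measurable L" for f
    by (simp add: nn_integral_distr flip: nn_integral_indicator)
  with nn_integral_transpose_sphere[OF _ assms, of "indicator E"]
  show "emeasure (distr L borel (\<lambda>M. M *v x)) E = emeasure (distr L borel (\<lambda>M. transpose M *v z)) E"
    by (simp del: transpose_matrix_vector)
qed simp

lemma integral_transpose_sphere:
  fixes f :: "real^'n \<Rightarrow> real"
  assumes "2 \<le> CARD('n)" "norm x = norm z" and [measurable]: "f \<in> borel_measurable borel"
  shows "(LINT M|L. f (M *v x)) = (LINT M|L. f (transpose M *v z))"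
proof -
  have "(LINT M|L. f (M *v x)) = (LINT y|distr L borel (\<lambda>M. M *v x). f y)"
    by (intro integral_distr[symmetric]) measurable
  also have "\<dots> = (LINT y|distr L borel (\<lambda>M. transpose M *v z). f y)"
    by (simp only: distr_transpose_sphere[OF assms(1,2)])
  also have "\<dots> = (LINT M|L. f (transpose M *v z))"
    by (intro integral_distr) measurable
  finally show ?thesis .
qed

text \<open>Every coordinate vector gives the same mean as \<open>x\<close>, and for each rotation
  the sum of the forms over all coordinate vectors is the constant \<open>trace B\<close>.\<close>

lemma integral_quadratic_form:
  assumes card: "2 \<le> CARD('n)" and x: "norm x = 1"
  shows "(LINT M|L. (M *v x) \<bullet> (B *v (M *v x))) = trace B / CARD('n)"
proof -
  let ?q = "\<lambda>y. y \<bullet> (B *v y)"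
  \<comment> \<open>Boundedness on unit vectors gives the integrability needed to exchange the
    finite sum with the integral.\<close>
  have int: "integrable L (\<lambda>M. ?q (transpose M *v axis i 1))" for i :: 'n
  proof (rule integrable_const_bound)
    show "AE M in L. norm (?q (transpose M *v axis i 1)) \<le> norm B"
      using AE_SO
    proof eventually_elim
      case (elim M)
      define y where "y = transpose M *v axis i 1"
      have "norm y = 1"
        using elim unfolding y_def by (subst orthogonal_matrix_norm) (simp_all add: SO_orthogonal)
      then have "\<bar>?q y\<bar> \<le> norm B"
        using Cauchy_Schwarz_ineq2[of y "B *v y"] norm_matrix_vector_mult_le[of B y] by simp
      then show ?case by (simp add: y_def)
    qed
  qed measurable
  have "real CARD('n) * (LINT M|L. ?q (M *v x)) = (\<Sum>i\<in>(UNIV :: 'n set). (LINT M|L. ?q (M *v x)))" by simp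
  also have "\<dots> = (\<Sum>i\<in>(UNIV :: 'n set). (LINT M|L. ?q (transpose M *v axis i 1)))"
    using card x by (intro sum.cong integral_transpose_sphere refl) auto
  also have "\<dots> = (LINT M|L. (\<Sum>i\<in>UNIV. ?q (transpose M *v axis i 1)))"
    by (intro Bochner_Integration.integral_sum[symmetric] int)
  also have "\<dots> = (LINT M|L. trace B)"
    using AE_SO by (intro integral_cong_AE)
      (auto elim!: eventually_mono simp: sum_axis_quadratic_form SO_orthogonal simp del: transpose_matrix_vector)
  also have "\<dots> = trace B" by (simp add: prob_space)
  finally show ?thesis by (simp add: field_simps)
qed

end

section \<open>From Haar measure on the group to a Borel measure on all matrices\<close>

lemma normalized_haar_SO_left_invariant:
  fixes \<mu> :: "(real^'n^'n) measure"
  assumes "normalized_haar_SO \<mu>"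
  shows "SO_left_invariant (distr \<mu> borel (\<lambda>M. M))"
proof -
  interpret prob_space \<mu> using assms by (simp add: normalized_haar_SO_def)
  have sets: "sets \<mu> = sets borel_SO" using assms by (simp add: normalized_haar_SO_def)
  have space: "space \<mu> = SO" using sets_eq_imp_space_eq[OF sets] by (simp add: space_restrict_space)
  have id [measurable]: "(\<lambda>M. M) \<in> borel_measurable \<mu>"
    unfolding measurable_cong_sets[OF sets refl] by (intro measurable_restrict_space1) simp
  let ?L = "distr \<mu> borel (\<lambda>M. M)"
  show ?thesis
  proof (intro SO_left_invariant.intro SO_left_invariant_axioms.intro)
    show "prob_space ?L" by (rule prob_space_distr) measurable
    show "sets ?L = sets borel" by simp
    show "AE M in ?L. M \<in> SO"
      using borel_closed[OF closed_SO] by (subst AE_distr_iff) (auto simp: space)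
    fix P :: "real^'n^'n" assume P: "P \<in> SO"
    have cont [measurable]: "(**) P \<in> borel_measurable borel"
      by (intro borel_measurable_continuous_onI continuous_intros)
    show "distr ?L borel ((**) P) = ?L"
    proof (rule measure_eqI)
      fix E assume "E \<in> sets (distr ?L borel ((**) P))"
      then have E [measurable]: "E \<in> sets borel" by simp
      define T where "T = {M \<in> space \<mu>. P ** M \<in> E}"
      have T: "T \<in> sets \<mu>" unfolding T_def by measurable
      \<comment> \<open>The definition of Haar measure speaks of images, a push-forward of
        preimages. Since \<open>P\<close> is invertible within \<open>SO\<close>, the image of the
        preimage \<open>T\<close> recovers all of \<open>E \<inter> SO\<close>.\<close>
      have "(**) P ` T = E \<inter> SO"
      proof safe
        fix M assume "M \<in> T" then show "P ** M \<in> E" "P ** M \<in> SO" using P by (auto simp: T_def space SO_mult)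
      next
        fix M assume M: "M \<in> E" "M \<in> SO"
        have "P ** (transpose P ** M) = M"
          using SO_orthogonal[OF P] by (simp add: matrix_mul_assoc orthogonal_matrix_def)
        moreover have "transpose P ** M \<in> SO" using M P by (intro SO_mult SO_transpose)
        ultimately show "M \<in> (**) P ` T" using M
          by (intro image_eqI[of _ _ "transpose P ** M"]) (auto simp: T_def space)
      qed
      moreover have "emeasure \<mu> ((**) P ` T) = emeasure \<mu> T"
        using assms P T unfolding normalized_haar_SO_def by blast
      ultimately have "emeasure \<mu> (E \<inter> SO) = emeasure \<mu> T" by simp
      then show "emeasure (distr ?L borel ((**) P)) E = emeasure ?L E"
        by (simp add: emeasure_distr distr_distr o_def T_def space vimage_def Int_def conj_commute)
    qed simp
  qed
qed

section \<open>Gaussian integrals\<close>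

text \<open>The integrand is a multiple of the centered normal density with variance
  \<open>1 / a\<close>.\<close>

lemma nn_integral_gaussian:
  fixes a :: real
  assumes a: "a > 0"
  shows "(\<integral>\<^sup>+x. ennreal (exp (- a * x\<^sup>2 / 2)) \<partial>lborel) = ennreal (sqrt (2 * pi) / sqrt a)"
proof -
  define \<sigma> where "\<sigma> = 1 / sqrt a"
  have \<sigma>: "\<sigma> > 0" "\<sigma>\<^sup>2 = 1 / a" using a by (simp_all add: \<sigma>_def power_divide)
  have eq: "exp (- a * x\<^sup>2 / 2) = (sqrt (2 * pi) / sqrt a) * normal_density 0 \<sigma> x" for x
    using a by (simp add: normal_density_def \<sigma>(2) real_sqrt_divide real_sqrt_mult field_simps)
  have "(\<integral>\<^sup>+x. ennreal (normal_density 0 \<sigma> x) \<partial>lborel) = 1"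
    using \<sigma>(1) by (subst nn_integral_eq_integral) (simp_all add: integrable_normal_density integral_normal_density)
  then show ?thesis
    unfolding eq using a by (subst ennreal_mult) (simp_all add: nn_integral_cmult)
qed

lemma nn_integral_gaussian_vec:
  fixes c :: "'n::finite \<Rightarrow> real"
  assumes c: "\<And>i. c i > 0"
  shows "(\<integral>\<^sup>+z. ennreal (exp (- (\<Sum>i\<in>UNIV. c i * (z $ i)\<^sup>2) / 2)) \<partial>(lborel :: (real^'n) measure))
    = ennreal (\<Prod>i\<in>UNIV. sqrt (2 * pi) / sqrt (c i))"
proof -
  \<comment> \<open>\<open>k\<close> inverts \<open>i\<close> \<mapsto> \<open>axis i 1\<close>, so
    that a product over coordinates can be written over \<open>Basis\<close>, the form in which
    Lebesgue measure factorizes.\<close>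
  define k :: "real^'n \<Rightarrow> 'n" where "k b = (THE i. b = axis i 1)" for b
  have k: "k (axis i 1) = i" for i by (auto simp: k_def axis_eq_axis)
  have basis: "Basis = range (\<lambda>i. axis i (1::real))" by (auto simp: Basis_vec_def)
  have inj: "inj (\<lambda>i::'n. axis i (1::real))" by (auto simp: inj_on_def axis_eq_axis)
  have "(\<integral>\<^sup>+z. ennreal (exp (- (\<Sum>i\<in>UNIV. c i * (z $ i)\<^sup>2) / 2)) \<partial>(lborel :: (real^'n) measure))
    = (\<integral>\<^sup>+z. (\<Prod>b\<in>Basis. ennreal (exp (- c (k b) * (z \<bullet> b)\<^sup>2 / 2))) \<partial>(lborel :: (real^'n) measure))"
  proof (rule nn_integral_cong)
    fix z :: "real^'n"
    have "exp (- (\<Sum>i\<in>UNIV. c i * (z $ i)\<^sup>2) / 2) = (\<Prod>i\<in>UNIV. exp (- c i * (z $ i)\<^sup>2 / 2))"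
      by (simp add: exp_sum[symmetric] sum_negf sum_divide_distrib)
    then show "ennreal (exp (- (\<Sum>i\<in>UNIV. c i * (z $ i)\<^sup>2) / 2)) = (\<Prod>b\<in>Basis. ennreal (exp (- c (k b) * (z \<bullet> b)\<^sup>2 / 2)))"
      by (simp add: basis prod.reindex[OF inj] k inner_axis prod_ennreal)
  qed
  also have "\<dots> = (\<Prod>b\<in>Basis. \<integral>\<^sup>+x. ennreal (exp (- c (k b) * x\<^sup>2 / 2)) \<partial>lborel)"
    by (rule nn_integral_lborel_prod) simp_all
  also have "\<dots> = (\<Prod>b\<in>(Basis :: (real^'n) set). ennreal (sqrt (2 * pi) / sqrt (c (k b))))"
    by (simp only: nn_integral_gaussian[OF c])
  also have "\<dots> = ennreal (\<Prod>i\<in>UNIV. sqrt (2 * pi) / sqrt (c i))"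
    using c by (simp add: basis prod.reindex[OF inj] k prod_ennreal less_imp_le)
  finally show ?thesis .
qed

section \<open>Invariance of Lebesgue measure under translations, reflections and orthogonal
  maps\<close>

lemma nn_integral_lborel_translate:
  fixes f :: "'a::euclidean_space \<Rightarrow> ennreal"
  assumes [measurable]: "f \<in> borel_measurable borel"
  shows "(\<integral>\<^sup>+z. f (a + z) \<partial>lborel) = (\<integral>\<^sup>+z. f z \<partial>lborel)"
proof -
  have "(\<integral>\<^sup>+z. f z \<partial>distr lborel borel ((+) a)) = (\<integral>\<^sup>+z. f (a + z) \<partial>lborel)"
    by (intro nn_integral_distr) measurable
  then show ?thesis by (simp add: lborel_distr_plus)
qed

lemma nn_integral_lborel_reflect:
  fixes f :: "'a::euclidean_space \<Rightarrow> ennreal"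
  assumes [measurable]: "f \<in> borel_measurable borel"
  shows "(\<integral>\<^sup>+z. f (a - z) \<partial>lborel) = (\<integral>\<^sup>+z. f z \<partial>lborel)"
proof -
  have eq: "lborel = distr lborel borel (\<lambda>z::'a. a - z)"
    using lborel_affine[of "-1" a] by (simp add: density_1)
  have "(\<integral>\<^sup>+z. f z \<partial>distr lborel borel (\<lambda>z. a - z)) = (\<integral>\<^sup>+z. f (a - z) \<partial>lborel)"
    by (intro nn_integral_distr) measurable
  then show ?thesis by (simp flip: eq)
qed

text \<open>Uniqueness of Haar measure on \<open>\<real>\<^sup>n\<close>, normalized by a Gaussian: the double integral of
  \<open>f (U x) g (y + U x)\<close> with \<open>g\<close> the Gaussian density is computed in both orders. The library's
  \<open>measure_orthogonal_image\<close> requires a well-ordered index type.\<close>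

lemma nn_integral_lborel_orthogonal:
  fixes U :: "real^'n^'n"
  assumes U: "orthogonal_matrix U" and f [measurable]: "f \<in> borel_measurable borel"
  shows "(\<integral>\<^sup>+z. f (U *v z) \<partial>lborel) = (\<integral>\<^sup>+z. f z \<partial>lborel)"
proof -
  define g where "g z = ennreal (exp (- (norm z)\<^sup>2 / 2))" for z :: "real^'n"
  define G where "G = (\<integral>\<^sup>+z. g z \<partial>lborel)"
  have g [measurable]: "g \<in> borel_measurable borel" unfolding g_def by measurable
  have G: "G = ennreal (\<Prod>i\<in>(UNIV::'n set). sqrt (2 * pi))"
    using nn_integral_gaussian_vec[of "\<lambda>_::'n. 1"] by (simp add: G_def g_def norm_vec_square)
  have radial: "g (U *v z) = g z" for z by (simp add: g_def orthogonal_matrix_norm[OF U])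
  have U_meas [measurable]: "(*v) U \<in> borel_measurable borel"
    by (intro borel_measurable_continuous_onI continuous_intros)
  have "(\<integral>\<^sup>+x. f (U *v x) \<partial>lborel) * G = (\<integral>\<^sup>+x. f (U *v x) * (\<integral>\<^sup>+y. g (U *v x + y) \<partial>lborel) \<partial>lborel)"
    by (simp add: nn_integral_lborel_translate nn_integral_multc G_def)
  also have "\<dots> = (\<integral>\<^sup>+x. (\<integral>\<^sup>+y. f (U *v x) * g (U *v x + y) \<partial>lborel) \<partial>lborel)"
    by (simp add: nn_integral_cmult)
  also have "\<dots> = (\<integral>\<^sup>+y. (\<integral>\<^sup>+x. f (U *v x) * g (U *v x + y) \<partial>lborel) \<partial>lborel)"
    by (rule lborel_pair.Fubini'[symmetric]) measurable
  also have "\<dots> = (\<integral>\<^sup>+y. (\<integral>\<^sup>+x. f (U *v x - y) * g x \<partial>lborel) \<partial>lborel)"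
  proof (rule nn_integral_cong)
    fix y
    \<comment> \<open>Translating \<open>x\<close> by \<open>- (transpose U *v y)\<close> turns
      \<open>U *v x\<close> into \<open>U *v x - y\<close>; the argument of \<open>g\<close> becomes
      \<open>U *v x\<close>, and \<open>g\<close> is radial.\<close>
    have "(\<integral>\<^sup>+x. f (U *v x) * g (U *v x + y) \<partial>lborel)
      = (\<integral>\<^sup>+x. f (U *v (- (transpose U *v y) + x)) * g (U *v (- (transpose U *v y) + x) + y) \<partial>lborel)"
      by (rule nn_integral_lborel_translate[symmetric]) measurable
    also have "\<dots> = (\<integral>\<^sup>+x. f (U *v x - y) * g x \<partial>lborel)"
    proof (rule nn_integral_cong)
      fix x
      have "U *v (- (transpose U *v y) + x) = U *v x - y"
        using orthogonal_matrix_mult_transpose[OF U, of y]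
        by (simp add: matrix_vector_mult_diff_distrib del: transpose_matrix_vector)
      then show "f (U *v (- (transpose U *v y) + x)) * g (U *v (- (transpose U *v y) + x) + y) = f (U *v x - y) * g x"
        by (simp add: radial)
    qed
    finally show "(\<integral>\<^sup>+x. f (U *v x) * g (U *v x + y) \<partial>lborel) = (\<integral>\<^sup>+x. f (U *v x - y) * g x \<partial>lborel)" .
  qed
  also have "\<dots> = (\<integral>\<^sup>+x. (\<integral>\<^sup>+y. f (U *v x - y) * g x \<partial>lborel) \<partial>lborel)"
    by (rule lborel_pair.Fubini') measurable
  also have "\<dots> = (\<integral>\<^sup>+x. (\<integral>\<^sup>+y. f y \<partial>lborel) * g x \<partial>lborel)"
    by (simp add: nn_integral_multc nn_integral_lborel_reflect)
  also have "\<dots> = (\<integral>\<^sup>+y. f y \<partial>lborel) * G"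
    by (simp add: nn_integral_cmult G_def)
  \<comment> \<open>The factor \<open>G\<close> cancels because it is finite and nonzero.\<close>
  finally show ?thesis by (simp add: G ennreal_mult_cancel_left mult.commute[of _ "ennreal _"])
qed

text \<open>Averaging the scale-invariant set \<open>H\<close> over rotations of any \<open>z \<noteq> 0\<close> gives the same number,
  so polar coordinates are not needed to compare the Haar measure with a radial density.\<close>

lemma (in SO_left_invariant) emeasure_cone_radial:
  fixes g :: "real^'n \<Rightarrow> ennreal"
  assumes card: "2 \<le> CARD('n)" and x: "norm x = 1"
    and H [measurable]: "H \<in> sets borel" and cone: "\<And>c z. c > 0 \<Longrightarrow> c *\<^sub>R z \<in> H \<longleftrightarrow> z \<in> H"
    and g [measurable]: "g \<in> borel_measurable borel" and radial: "\<And>y z. norm y = norm z \<Longrightarrow> g y = g z"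
  shows "emeasure L {M \<in> space L. M *v x \<in> H} * (\<integral>\<^sup>+z. g z \<partial>lborel) = (\<integral>\<^sup>+z. indicator H z * g z \<partial>lborel)"
proof -
  let ?h = "\<lambda>z. indicator H z * g z"
  have sf: "pair_sigma_finite L lborel"
    by (intro pair_sigma_finite.intro prob_space_imp_sigma_finite prob_space_axioms sigma_finite_lborel)
  interpret P: pair_sigma_finite L lborel by (rule sf)
  let ?p = "emeasure L {M \<in> space L. M *v x \<in> H}"
  have sets_pair: "sets (L \<Otimes>\<^sub>M lborel) = sets borel"
    unfolding borel_prod[symmetric] by (intro sets_pair_measure_cong sets_L sets_lborel)
  have h [measurable]: "?h \<in> borel_measurable borel" by measurable
  have "(\<lambda>p. ?h (transpose (fst p) *v snd p)) \<in> borel_measurable borel"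
    by (intro measurable_compose[OF _ h] borel_measurable_continuous_onI continuous_intros)
  then have joint: "(\<lambda>(M, z). ?h (transpose M *v z)) \<in> borel_measurable (L \<Otimes>\<^sub>M lborel)"
    by (subst measurable_cong_sets[OF sets_pair refl]) (simp add: split_beta')
  have p: "?p = (\<integral>\<^sup>+M. indicator H (transpose M *v z) \<partial>L)" if "z \<noteq> 0" for z
  proof -
    \<comment> \<open>Scale invariance of \<open>H\<close> lets the unit vector \<open>x\<close> be
      stretched to the length of \<open>z\<close>, where transitivity on the sphere applies.\<close>
    have scale: "indicator H (norm z *\<^sub>R y) = (indicator H y :: ennreal)" for y
      using cone[of "norm z" y] that by (simp add: indicator_def)
    have [measurable]: "{M \<in> space L. M *v x \<in> H} \<in> sets L" by measurable
    have "?p = (\<integral>\<^sup>+M. indicator {M \<in> space L. M *v x \<in> H} M \<partial>L)" by (rule nn_integral_indicator[symmetric]) measurable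
    also have "\<dots> = (\<integral>\<^sup>+M. indicator H (M *v x) \<partial>L)"
      by (intro nn_integral_cong) (simp add: indicator_def)
    also have "\<dots> = (\<integral>\<^sup>+M. indicator H (M *v (norm z *\<^sub>R x)) \<partial>L)"
      by (simp add: scale matrix_vector_mult_scaleR)
    also have "\<dots> = (\<integral>\<^sup>+M. indicator H (transpose M *v z) \<partial>L)"
      using card x by (intro nn_integral_transpose_sphere) auto
    finally show ?thesis .
  qed
  have "?p * (\<integral>\<^sup>+z. g z \<partial>lborel) = (\<integral>\<^sup>+z. ?p * g z \<partial>lborel)" by (simp add: nn_integral_cmult)
  also have "\<dots> = (\<integral>\<^sup>+z. (\<integral>\<^sup>+M. ?h (transpose M *v z) \<partial>L) \<partial>lborel)"
  \<comment> \<open>The origin, excluded by the rescaling, is a Lebesgue null set.\<close>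
  proof (rule nn_integral_cong_AE, use AE_lborel_singleton[of 0] in eventually_elim)
    case (elim z)
    have "?p * g z = (\<integral>\<^sup>+M. indicator H (transpose M *v z) * g z \<partial>L)"
      unfolding p[OF elim] by (rule nn_integral_multc[symmetric]) measurable
    also have "\<dots> = (\<integral>\<^sup>+M. ?h (transpose M *v z) \<partial>L)"
    proof (rule nn_integral_cong_AE, use AE_SO in eventually_elim)
      case (elim M)
      then have "norm (transpose M *v z) = norm z"
        by (intro orthogonal_matrix_norm SO_orthogonal SO_transpose)
      from radial[OF this] show ?case by simp
    qed
    finally show ?case .
  qed
  also have "\<dots> = (\<integral>\<^sup>+M. (\<integral>\<^sup>+z. ?h (transpose M *v z) \<partial>lborel) \<partial>L)"
    by (rule P.Fubini') (rule joint)
  also have "\<dots> = (\<integral>\<^sup>+M. (\<integral>\<^sup>+z. ?h z \<partial>lborel) \<partial>L)"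
  proof (rule nn_integral_cong_AE, use AE_SO in eventually_elim)
    case (elim M)
    then show ?case by (intro nn_integral_lborel_orthogonal h SO_orthogonal SO_transpose)
  qed
  also have "\<dots> = (\<integral>\<^sup>+z. ?h z \<partial>lborel)" by (simp add: emeasure_space_1)
  finally show ?thesis .
qed

text \<open>The difference of the two sides has derivative \<open>x * (1 - 2 * x) / (1 - x)\<close>,
  which has the sign of \<open>x\<close> for \<open>x \<le> 1/2\<close>; its minimum is therefore
  the value 0 at 0. Negative \<open>u\<close> is included because the shifted eigenvalues may have
  either sign.\<close>

lemma ln_one_minus_ge:
  fixes u :: real
  assumes "u \<le> 1/2"
  shows "- u - u\<^sup>2 \<le> ln (1 - u)"
proof -
  define f where "f x = ln (1 - x) + x + x\<^sup>2" for x :: real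
  have deriv: "(f has_real_derivative x * (1 - 2 * x) / (1 - x)) (at x)" if "x \<le> 1/2" for x
    unfolding f_def using that
    by (auto intro!: derivative_eq_intros simp: field_simps power2_eq_square)
  have "f 0 \<le> f u"
  proof (cases "u \<ge> 0")
    case True
    then show ?thesis
    proof (rule DERIV_nonneg_imp_nondecreasing)
      fix x assume "0 \<le> x" "x \<le> u"
      then show "\<exists>y. (f has_real_derivative y) (at x) \<and> 0 \<le> y"
        using assms deriv[of x] by (intro exI[of _ "x * (1 - 2 * x) / (1 - x)"]) auto
    qed
  next
    case False
    then have "u \<le> 0" by simp
    then show ?thesis
    proof (rule DERIV_nonpos_imp_nonincreasing)
      fix x assume "u \<le> x" "x \<le> 0"
      then show "\<exists>y. (f has_real_derivative y) (at x) \<and> y \<le> 0"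
        using deriv[of x] by (intro exI[of _ "x * (1 - 2 * x) / (1 - x)"])
          (auto intro!: divide_nonpos_pos mult_nonpos_nonneg)
    qed
  qed
  then show ?thesis by (simp add: f_def)
qed

lemma inverse_sqrt_one_minus_le:
  fixes u :: real
  assumes "u \<le> 1/2"
  shows "1 / sqrt (1 - u) \<le> exp ((u + u\<^sup>2) / 2)"
proof -
  have "1 / sqrt (1 - u) = exp (- ln (1 - u) / 2)"
    using assms by (simp add: exp_minus ln_sqrt[symmetric] inverse_eq_divide)
  also have "\<dots> \<le> exp ((u + u\<^sup>2) / 2)" using ln_one_minus_ge[OF assms] by simp
  finally show ?thesis .
qed

section \<open>The concentration inequality\<close>

text \<open>By the logarithm estimate the exponent is at most
  \<open>- s * n * t + 10 * s\<^sup>2 * n * \<rho>\<^sup>2\<close>, where \<open>n\<close> is the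
  dimension: the deviations of \<open>l i\<close> from their average cancel to first order. The
  chosen \<open>s\<close> minimizes this quadratic.\<close>

lemma gaussian_quotient_le:
  fixes l :: "'n::finite \<Rightarrow> real" and t :: real
  assumes l: "\<And>i. \<bar>l i\<bar> \<le> \<rho>" and m: "m = (\<Sum>i\<in>UNIV. l i) / CARD('n)"
    and t: "0 < t" "t \<le> 2 * \<rho>"
  defines "s \<equiv> t / (20 * \<rho>\<^sup>2)"
  shows "2 * s * (l i - m - t) \<le> 1 / 2"
    and "(\<Prod>i\<in>UNIV. 1 / sqrt (1 - 2 * s * (l i - m - t))) \<le> exp (- (CARD('n) * t\<^sup>2 / (40 * \<rho>\<^sup>2)))"
proof -
  let ?n = "real CARD('n)"
  let ?u = "\<lambda>i. 2 * s * (l i - m - t)"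
  have \<rho>: "\<rho> > 0" using t by simp
  have sum_l: "(\<Sum>i\<in>UNIV. l i) = ?n * m" using m by simp
  have "?n * m \<ge> (\<Sum>i\<in>(UNIV::'n set). - \<rho>)"
    unfolding sum_l[symmetric] using l by (intro sum_mono) (simp add: abs_le_iff minus_le_iff)
  then have "?n * - \<rho> \<le> ?n * m" by simp
  then have m_ge: "- \<rho> \<le> m" by (rule mult_left_le_imp_le) simp
  show u: "?u i \<le> 1 / 2" for i
  proof -
    have "l i - m - t \<le> 2 * \<rho> - t" using l[of i] m_ge by simp
    then have "?u i \<le> 2 * s * (2 * \<rho> - t)"
      using t by (intro mult_left_mono) (auto simp: s_def)
    also have "\<dots> = t * (2 * \<rho> - t) / (10 * \<rho>\<^sup>2)" using \<rho> by (simp add: s_def)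
    \<comment> \<open>This is \<open>t * (2 * \<rho> - t) \<le> \<rho>\<^sup>2\<close>, that is,
      nonnegativity of the square of \<open>\<rho> - t\<close>.\<close>
    also have "\<dots> \<le> 1 / 10"
      using \<rho> zero_le_power2[of "\<rho> - t"] by (simp add: divide_le_eq power2_eq_square algebra_simps)
    finally show ?thesis by simp
  qed
  have "(\<Sum>i\<in>UNIV. (l i - m - t)\<^sup>2) = (\<Sum>i\<in>UNIV. (l i)\<^sup>2) + ?n * (t\<^sup>2 - m\<^sup>2)"
  proof -
    have "(\<Sum>i\<in>UNIV. (l i - m - t)\<^sup>2) = (\<Sum>i\<in>UNIV. (l i)\<^sup>2 - 2 * (m + t) * l i + (m + t)\<^sup>2)"
      by (intro sum.cong) (auto simp: power2_eq_square algebra_simps)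
    also have "\<dots> = (\<Sum>i\<in>UNIV. (l i)\<^sup>2) - 2 * (m + t) * (?n * m) + ?n * (m + t)\<^sup>2"
      by (simp add: sum.distrib sum_subtractf sum_l flip: sum_distrib_left)
    finally show ?thesis by (simp add: power2_eq_square algebra_simps)
  qed
  \<comment> \<open>The eventual constant 5 is 1 from the eigenvalues plus 4 from
    \<open>t \<le> 2 * \<rho>\<close>.\<close>
  also have "\<dots> \<le> (\<Sum>i\<in>(UNIV::'n set). \<rho>\<^sup>2) + ?n * (4 * \<rho>\<^sup>2)"
  proof (intro add_mono sum_mono mult_left_mono)
    show "(l i)\<^sup>2 \<le> \<rho>\<^sup>2" for i using l[of i] \<rho> by (simp add: abs_le_square_iff[symmetric])
    have "t\<^sup>2 \<le> (2 * \<rho>)\<^sup>2" using t by (intro power_mono) auto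
    then have "t\<^sup>2 \<le> 4 * \<rho>\<^sup>2" by (simp add: power_mult_distrib)
    then show "t\<^sup>2 - m\<^sup>2 \<le> 4 * \<rho>\<^sup>2" using zero_le_power2[of m] by linarith
  qed simp
  finally have sq: "(\<Sum>i\<in>UNIV. (l i - m - t)\<^sup>2) \<le> 5 * ?n * \<rho>\<^sup>2" by simp
  have "(\<Sum>i\<in>UNIV. (?u i + (?u i)\<^sup>2) / 2) = s * (\<Sum>i\<in>UNIV. l i - m - t) + 2 * s\<^sup>2 * (\<Sum>i\<in>UNIV. (l i - m - t)\<^sup>2)"
    unfolding sum_distrib_left sum.distrib[symmetric]
    by (intro sum.cong) (auto simp: power2_eq_square field_simps)
  also have "(\<Sum>i\<in>UNIV. l i - m - t) = - ?n * t" by (simp add: sum_subtractf sum_l)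
  also have "s * (- ?n * t) + 2 * s\<^sup>2 * (\<Sum>i\<in>UNIV. (l i - m - t)\<^sup>2) \<le> s * (- ?n * t) + 2 * s\<^sup>2 * (5 * ?n * \<rho>\<^sup>2)"
    using sq by (intro add_left_mono mult_left_mono) auto
  also have "\<dots> = - (?n * t\<^sup>2 / (40 * \<rho>\<^sup>2))"
    using \<rho> by (simp add: s_def power2_eq_square field_simps)
  finally have exponent: "(\<Sum>i\<in>UNIV. (?u i + (?u i)\<^sup>2) / 2) \<le> - (?n * t\<^sup>2 / (40 * \<rho>\<^sup>2))" .
  have "(\<Prod>i\<in>UNIV. 1 / sqrt (1 - ?u i)) \<le> (\<Prod>i\<in>UNIV. exp ((?u i + (?u i)\<^sup>2) / 2))"
    using u by (intro prod_mono conjI inverse_sqrt_one_minus_le) (auto intro: order_trans[OF u])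
  also have "\<dots> = exp (\<Sum>i\<in>UNIV. (?u i + (?u i)\<^sup>2) / 2)" by (simp add: exp_sum)
  also have "\<dots> \<le> exp (- (?n * t\<^sup>2 / (40 * \<rho>\<^sup>2)))" using exponent by simp
  finally show "(\<Prod>i\<in>UNIV. 1 / sqrt (1 - ?u i)) \<le> exp (- (?n * t\<^sup>2 / (40 * \<rho>\<^sup>2)))" .
qed

section \<open>Tail bounds for the quadratic form of a random rotation\<close>

locale SO_quadratic_form = SO_left_invariant L + diagonalized B U l
  for L :: "(real^'n^'n) measure" and B U :: "real^'n^'n" and l :: "'n \<Rightarrow> real" +
  fixes x :: "real^'n"
  assumes card: "2 \<le> CARD('n)" and x: "norm x = 1"
begin

abbreviation mean :: real where "mean \<equiv> trace B / CARD('n)"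

lemma tail_le:
  fixes t :: real
  assumes t: "0 < t" "t \<le> 2 * spectral_radius B"
  shows "prob {M \<in> space L. (M *v x) \<bullet> (B *v (M *v x)) \<ge> mean + t}
    \<le> exp (- (CARD('n) * t\<^sup>2 / (40 * (spectral_radius B)\<^sup>2)))"
proof -
  let ?q = "\<lambda>y. y \<bullet> (B *v y)"
  define s where "s = t / (20 * (spectral_radius B)\<^sup>2)"
  \<comment> \<open>In eigenbasis coordinates these are the coefficients of the Gaussian exponent
    after tilting by \<open>s\<close> times the form that defines the event.\<close>
  define c where "c i = 1 - 2 * s * (l i - mean - t)" for i
  have "mean = (\<Sum>i\<in>UNIV. l i) / CARD('n)" by (simp add: trace_eq)
  note bounds = gaussian_quotient_le[OF eigenvalue_le this t, folded s_def]
  have c: "c i > 0" for i using bounds(1)[of i] by (simp add: c_def)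
  have s: "s \<ge> 0" using t by (simp add: s_def)
  \<comment> \<open>On unit vectors this is the tail event; the factor
    \<open>(norm y)\<^sup>2\<close> makes both sides homogeneous of degree 2, so \<open>H\<close> is
    a cone.\<close>
  define H where "H = {y :: real^'n. (mean + t) * (norm y)\<^sup>2 \<le> ?q y}"
  define g where "g z = ennreal (exp (- (norm z)\<^sup>2 / 2))" for z :: "real^'n"
  let ?G = "\<Prod>i\<in>(UNIV::'n set). sqrt (2 * pi)"
  have G: "(\<integral>\<^sup>+z. g z \<partial>lborel) = ennreal ?G" "?G > 0"
    using nn_integral_gaussian_vec[of "\<lambda>_::'n. 1"] by (simp_all add: g_def norm_vec_square)
  have H [measurable]: "H \<in> sets borel" unfolding H_def by measurable
  have g [measurable]: "g \<in> borel_measurable borel" unfolding g_def by measurable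
  have "prob {M \<in> space L. ?q (M *v x) \<ge> mean + t} = prob {M \<in> space L. M *v x \<in> H}"
  proof (rule prob_eq_AE)
    show "AE M in L. (mean + t \<le> ?q (M *v x)) = (M *v x \<in> H)"
      using AE_SO by eventually_elim (simp add: H_def orthogonal_matrix_norm SO_orthogonal x)
  qed measurable
  moreover have "ennreal (prob {M \<in> space L. M *v x \<in> H}) * ennreal ?G \<le> ennreal ((\<Prod>i\<in>UNIV. 1 / sqrt (c i)) * ?G)"
  proof -
    have "ennreal (prob {M \<in> space L. M *v x \<in> H}) * ennreal ?G = (\<integral>\<^sup>+z. indicator H z * g z \<partial>lborel)"
      unfolding G(1)[symmetric] emeasure_eq_measure[symmetric]
    proof (rule emeasure_cone_radial[OF card x H])
      show "r *\<^sub>R z \<in> H \<longleftrightarrow> z \<in> H" if "r > 0" for r z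
        using that by (simp add: H_def matrix_vector_mult_scaleR power2_eq_square mult_ac)
    qed (auto simp: g_def)
    also have "\<dots> \<le> (\<integral>\<^sup>+z. ennreal (exp (- (\<Sum>i\<in>UNIV. c i * ((transpose U *v z) $ i)\<^sup>2) / 2)) \<partial>lborel)"
    proof (rule nn_integral_mono)
      fix z :: "real^'n"
      let ?w = "transpose U *v z"
      have "(\<Sum>i\<in>UNIV. c i * (?w $ i)\<^sup>2)
        = (\<Sum>i\<in>UNIV. (?w $ i)\<^sup>2 - 2 * s * (l i * (?w $ i)\<^sup>2 - (mean + t) * (?w $ i)\<^sup>2))"
        by (intro sum.cong) (auto simp: c_def algebra_simps simp del: transpose_matrix_vector)
      also have "\<dots> = (norm z)\<^sup>2 - 2 * s * (?q z - (mean + t) * (norm z)\<^sup>2)"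
        by (simp add: norm_square_eq quadratic_form_eq sum_subtractf right_diff_distrib sum_distrib_left mult_ac
            del: transpose_matrix_vector)
      finally have eq: "(\<Sum>i\<in>UNIV. c i * (?w $ i)\<^sup>2) = (norm z)\<^sup>2 - 2 * s * (?q z - (mean + t) * (norm z)\<^sup>2)" .
      \<comment> \<open>Exponential Markov inequality in pointwise form: on \<open>H\<close> the
        tilting factor is at least 1, and off \<open>H\<close> the left side vanishes.\<close>
      have "z \<in> H \<Longrightarrow> s * (?q z - (mean + t) * (norm z)\<^sup>2) \<ge> 0"
        using s by (intro mult_nonneg_nonneg) (auto simp: H_def)
      then show "indicator H z * g z \<le> ennreal (exp (- (\<Sum>i\<in>UNIV. c i * (?w $ i)\<^sup>2) / 2))"
        unfolding eq g_def by (cases "z \<in> H") (auto intro!: ennreal_leI)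
    qed
    \<comment> \<open>Rotating Lebesgue measure by \<open>transpose U\<close> makes the exponent
      diagonal in the integration variable.\<close>
    also have "\<dots> = (\<integral>\<^sup>+w. ennreal (exp (- (\<Sum>i\<in>UNIV. c i * (w $ i)\<^sup>2) / 2)) \<partial>(lborel :: (real^'n) measure))"
      using U by (intro nn_integral_lborel_orthogonal[where f = "\<lambda>w. ennreal (exp (- (\<Sum>i\<in>UNIV. c i * (w $ i)\<^sup>2) / 2))"])
        (auto intro!: measurable_compose[OF _ measurable_ennreal] borel_measurable_continuous_onI continuous_intros)
    also have "\<dots> = ennreal (\<Prod>i\<in>UNIV. sqrt (2 * pi) / sqrt (c i))"
      by (rule nn_integral_gaussian_vec) (rule c)
    also have "(\<Prod>i\<in>UNIV. sqrt (2 * pi) / sqrt (c i)) = (\<Prod>i\<in>UNIV. 1 / sqrt (c i)) * ?G"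
      unfolding prod.distrib[symmetric] by simp
    finally show ?thesis .
  qed
  then have "prob {M \<in> space L. M *v x \<in> H} \<le> (\<Prod>i\<in>UNIV. 1 / sqrt (c i))"
    using G(2) c by (simp add: ennreal_mult'[symmetric] ennreal_le_iff prod_nonneg less_imp_le)
  ultimately show ?thesis using bounds(2) by (simp add: c_def)
qed

text \<open>The form is at most the spectral radius on unit vectors, while the mean is at least its
  negative. The case of spectral radius 0 falls under this lemma for every positive
  \<open>t\<close>.\<close>

lemma tail_eq_0:
  fixes t :: real
  assumes t: "2 * spectral_radius B < t"
  shows "prob {M \<in> space L. (M *v x) \<bullet> (B *v (M *v x)) \<ge> mean + t} = 0"
proof -
  have "real CARD('n) * - spectral_radius B = (\<Sum>i\<in>(UNIV::'n set). - spectral_radius B)" by simp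
  also have "\<dots> \<le> (\<Sum>i\<in>UNIV. l i)"
    using eigenvalue_le by (intro sum_mono) (simp add: abs_le_iff minus_le_iff)
  finally have mean: "- spectral_radius B \<le> mean" by (simp add: trace_eq field_simps)
  have "prob {M \<in> space L. (M *v x) \<bullet> (B *v (M *v x)) \<ge> mean + t} = prob {M \<in> space L. False}"
  proof (rule prob_eq_AE)
    show "AE M in L. (mean + t \<le> (M *v x) \<bullet> (B *v (M *v x))) = False"
      using AE_SO
    proof eventually_elim
      case (elim M)
      define y where "y = M *v x"
      have "norm y = 1" using elim x by (simp add: y_def orthogonal_matrix_norm SO_orthogonal)
      then have "y \<bullet> (B *v y) \<le> spectral_radius B"
        using norm_cauchy_schwarz[of y "B *v y"] norm_mult_le[of y] by simp
      then show ?case using mean t by (simp add: y_def)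
    qed
  qed measurable
  then show ?thesis by simp
qed

end

section \<open>Both bounds for an arbitrary Haar-distributed rotation\<close>

theorem theorem2p2:
  fixes A :: "real^'n^'n" and x :: "real^'n"
  assumes "x \<in> sphere 0 1"
  shows "(\<forall>P\<in>SO. \<forall>Q\<in>SO. \<bar>quad_at A x P - quad_at A x Q\<bar>
            \<le> 2 * spectral_radius (symmetric_part A) * hs_dist P Q) \<and>
         (\<forall>(S :: 'b measure) M. haar_distributed_SO S M \<longrightarrow>
            (\<forall>t>0. measure S {\<omega> \<in> space S.
                      quad_at A x (M \<omega>) \<ge> (LINT \<omega>'|S. quad_at A x (M \<omega>')) + t}
                   \<le> exp (- ((real CARD('n) - 2) * t^2 / (64 * (spectral_radius (symmetric_part A))^2)))
                 \<comment> \<open>for \<open>\<rho>(B) = 0\<close>, where division by zero makes the bound above trivial, the bound is \<open>exp(-\<infinity>) = 0\<close>\<close>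
                 \<and> (spectral_radius (symmetric_part A) = 0 \<and> CARD('n) > 2 \<longrightarrow>
                    measure S {\<omega> \<in> space S.
                      quad_at A x (M \<omega>) \<ge> (LINT \<omega>'|S. quad_at A x (M \<omega>')) + t} = 0)))"
proof (intro conjI ballI allI impI)
  have x: "norm x = 1" using assms by simp
  show "\<bar>quad_at A x P - quad_at A x Q\<bar> \<le> 2 * spectral_radius (symmetric_part A) * hs_dist P Q"
    if "P \<in> SO" "Q \<in> SO" for P Q
    using quad_at_Lipschitz[OF x that] .
  define \<rho> where "\<rho> = spectral_radius (symmetric_part A)"
  fix S :: "'b measure" and M :: "'b \<Rightarrow> real^'n^'n" and t :: real
  assume haar: "haar_distributed_SO S M" and t: "t > 0"
  define p where "p = measure S {\<omega> \<in> space S. quad_at A x (M \<omega>) \<ge> (LINT \<omega>'|S. quad_at A x (M \<omega>')) + t}"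
  define n where "n = real CARD('n)"
  interpret S: prob_space S using haar by (simp add: haar_distributed_SO_def)
  have tail: "(t \<le> 2 * \<rho> \<longrightarrow> p \<le> exp (- (n * t\<^sup>2 / (40 * \<rho>\<^sup>2)))) \<and> (2 * \<rho> < t \<longrightarrow> p = 0)"
    if card: "CARD('n) > 2"
  proof -
    have M_SO: "M \<in> measurable S borel_SO" using haar by (simp add: haar_distributed_SO_def)
    then have M [measurable]: "M \<in> borel_measurable S" by (simp add: measurable_restrict_space2_iff)
    \<comment> \<open>The law of \<open>M\<close> on \<open>borel_SO\<close> and its law on all
      matrices agree after forgetting the restriction, so the left-invariant setting applies to
      \<open>distr S borel M\<close>.\<close>
    have "distr (distr S borel_SO M) borel (\<lambda>M. M) = distr S borel M"
      using M_SO by (subst distr_distr) (auto simp: o_def intro: measurable_restrict_space1)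
    then have "SO_left_invariant (distr S borel M)"
      using normalized_haar_SO_left_invariant[of "distr S borel_SO M"] haar
      by (simp add: haar_distributed_SO_def)
    moreover obtain U l where "diagonalized (symmetric_part A) U l" by (rule symmetric_part_diagonalized)
    ultimately interpret SO_quadratic_form "distr S borel M" "symmetric_part A" U l x
      using card x by (intro SO_quadratic_form.intro SO_quadratic_form_axioms.intro) auto
    have quad_meas [measurable]: "quad_at A x \<in> borel_measurable borel"
      unfolding quad_at_def by (intro borel_measurable_continuous_onI continuous_intros)
    have "(LINT \<omega>|S. quad_at A x (M \<omega>)) = (LINT N|distr S borel M. quad_at A x N)"
      by (rule integral_distr[symmetric]) measurable
    also have "\<dots> = mean"
      unfolding quad_at_symmetric_part using card x by (intro integral_quadratic_form) simp_all
    finally have "p = measure (distr S borel M) {N \<in> space (distr S borel M). quad_at A x N \<ge> mean + t}"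
      unfolding p_def by (subst measure_distr) (auto simp: vimage_def Int_def conj_commute)
    then show ?thesis
      using tail_le[OF t] tail_eq_0[of t] by (simp add: quad_at_symmetric_part \<rho>_def n_def)
  qed
  have "p \<le> exp (- ((n - 2) * t\<^sup>2 / (64 * \<rho>\<^sup>2)))"
  proof (cases "CARD('n) > 2")
    case True
    show ?thesis
    proof (cases "t \<le> 2 * \<rho>")
      case le: True
      \<comment> \<open>The bound already obtained is stronger: the numerator \<open>n\<close>
        exceeds \<open>n - 2\<close> and the denominator has 40 in place of 64.\<close>
      have "(n - 2) * t\<^sup>2 / (64 * \<rho>\<^sup>2) \<le> n * t\<^sup>2 / (40 * \<rho>\<^sup>2)"
        using le t True by (intro frac_le mult_right_mono) (auto simp: n_def)
      then have "exp (- (n * t\<^sup>2 / (40 * \<rho>\<^sup>2))) \<le> exp (- ((n - 2) * t\<^sup>2 / (64 * \<rho>\<^sup>2)))" by simp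
      with tail[OF True] le show ?thesis by linarith
    qed (use tail[OF True] in simp)
  next
    case False
    then have "(n - 2) * t\<^sup>2 / (64 * \<rho>\<^sup>2) \<le> 0"
      by (intro divide_nonpos_nonneg mult_nonpos_nonneg) (auto simp: n_def)
    then have "1 \<le> exp (- ((n - 2) * t\<^sup>2 / (64 * \<rho>\<^sup>2)))" by simp
    then show ?thesis using S.prob_le_1 unfolding p_def by (rule order_trans[rotated])
  qed
  then show "measure S {\<omega> \<in> space S. quad_at A x (M \<omega>) \<ge> (LINT \<omega>'|S. quad_at A x (M \<omega>')) + t}
      \<le> exp (- ((real CARD('n) - 2) * t^2 / (64 * (spectral_radius (symmetric_part A))^2)))"
    by (simp only: p_def n_def \<rho>_def)
  show "measure S {\<omega> \<in> space S. quad_at A x (M \<omega>) \<ge> (LINT \<omega>'|S. quad_at A x (M \<omega>')) + t} = 0"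
    if "spectral_radius (symmetric_part A) = 0 \<and> CARD('n) > 2"
    using tail that t by (simp add: p_def \<rho>_def)
qed

end
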